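(* Let $G=\{g_1,\dots,g_m\}$ and $H=\{h_1,\dots,h_n\}$ be two finite discrete groups of order $m$ and $n$, respectively, and let $k=(m-1)(n-1)$. Then the monodromy action is given by a faithful representation $$\varphi: G\times H\to \mathrm{Out}(F_k),$$ where for any $t\in G\times H$ the image $\varphi(t)=\varphi_t$ is given by the following equations (for all indices $i,l,j$ in the first line and $i,j,l$ in the second for which the elements are defined): $$\varphi_{g_l}([g_i,h_j])=g_l[g_i,h_j]g_l^{-1}=[g_lg_i,h_j]\,[h_j,g_l],$$ $$\varphi_{h_l}([g_i,h_j])=h_l[g_i,h_j]h_l^{-1}=[h_l,g_i]\,[g_i,h_lh_j].$$
   Context: Commutators are $[x,y]=xyx^{-1}y^{-1}$, taken in the free product $G\ast H$. For a finite discrete group $G$, $EG$ is a contractible space with a free, properly discontinuous $G$-action, $BG=EG/G$, and $G\subset EG$ is included as an orbit. Let $K_0=\{\varnothing,\{1\},\{2\}\}$ be the simplicial complex consisting of two vertices and no edge. The polyhedral product of pairs $(X_1,A_1),(X_2,A_2)$ for $K_0$ is $Z_{K_0}(\underline X,\underline A)=(X_1\times A_2)\cup(A_1\times X_2)\subseteq X_1\times X_2$. The Denham--Suciu fibration for $G,H$ and $K_0$ is $$Z_{K_0}(\underline{EG},\underline{G})\to BG\vee BH\to BG\times BH,$$ where the fibre is formed from the pairs $(EG,G),(EH,H)$. All three spaces are Eilenberg--Mac Lane spaces $K(\pi,1)$, and on fundamental groups the fibration gives the short exact sequence $$1\to F_k\to G\ast H\to G\times H\to 1,$$ in which $G\ast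 H\to G\times H$ is the canonical projection and the kernel $F_k\cong\pi_1(Z_{K_0}(\underline{EG},\underline{G}))$ is a free group of rank $k=(m-1)(n-1)$, with basis the commutators $[g,h]$, $1\ne g\in G$, $1\neq h\in H$ (a commutator with an identity entry is trivial). The monodromy action is the homomorphism $G\times H\to\mathrm{Out}(F_k)=\mathrm{Aut}(F_k)/\mathrm{Inn}(F_k)$ induced by the conjugation homomorphism $G\ast H\to \mathrm{Aut}(F_k)$, $x\mapsto(w\mapsto xwx^{-1})$. The displayed equations describe, for $t=g_l\in G$ and $t=h_l\in H$, the automorphism of $F_k$ representing the outer class $\varphi_t$.
   Formalization: Faithfulness is asserted only if k ≥ 2 or m = n = 1; it is false otherwise: for m = n = 2, Out(F_1) has 2 elements but G×H has 4, and if exactly one group is trivial then Out(F_0) is trivial but G×H is not. *)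

theory Defs
  imports "HOL-Algebra.Coset" "HOL-Algebra.Bij"
begin

definition commutator :: "('a, 'c) monoid_scheme \<Rightarrow> 'a \<Rightarrow> 'a \<Rightarrow> 'a" where
  "commutator K x y = x \<otimes>\<^bsub>K\<^esub> y \<otimes>\<^bsub>K\<^esub> inv\<^bsub>K\<^esub> x \<otimes>\<^bsub>K\<^esub> inv\<^bsub>K\<^esub> y"

section \<open>The free product of two groups\<close>

definition fp_words ::
  "('a, 'c) monoid_scheme \<Rightarrow> ('b, 'd) monoid_scheme \<Rightarrow> ('a + 'b) list set" where
  "fp_words G H = lists (carrier G <+> carrier H)"

text \<open>The congruence on words generated by multiplication inside each factor and by
  deletion of identity letters.\<close>

inductive_set fp_rel ::
  "('a, 'c) monoid_scheme \<Rightarrow> ('b, 'd) monoid_scheme \<Rightarrow> (('a + 'b) list \<times> ('a + 'b) list) set"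
  for G :: "('a, 'c) monoid_scheme" and H :: "('b, 'd) monoid_scheme" where
  refl: "w \<in> fp_words G H \<Longrightarrow> (w, w) \<in> fp_rel G H"
| sym: "(v, w) \<in> fp_rel G H \<Longrightarrow> (w, v) \<in> fp_rel G H"
| trans: "(u, v) \<in> fp_rel G H \<Longrightarrow> (v, w) \<in> fp_rel G H \<Longrightarrow> (u, w) \<in> fp_rel G H"
| one_left: "u \<in> fp_words G H \<Longrightarrow> v \<in> fp_words G H \<Longrightarrow>
    (u @ [Inl \<one>\<^bsub>G\<^esub>] @ v, u @ v) \<in> fp_rel G H"
| one_right: "u \<in> fp_words G H \<Longrightarrow> v \<in> fp_words G H \<Longrightarrow>
    (u @ [Inr \<one>\<^bsub>H\<^esub>] @ v, u @ v) \<in> fp_rel G H"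
| mult_left: "u \<in> fp_words G H \<Longrightarrow> v \<in> fp_words G H \<Longrightarrow>
    a \<in> carrier G \<Longrightarrow> a' \<in> carrier G \<Longrightarrow>
    (u @ [Inl a, Inl a'] @ v, u @ [Inl (a \<otimes>\<^bsub>G\<^esub> a')] @ v) \<in> fp_rel G H"
| mult_right: "u \<in> fp_words G H \<Longrightarrow> v \<in> fp_words G H \<Longrightarrow>
    b \<in> carrier H \<Longrightarrow> b' \<in> carrier H \<Longrightarrow>
    (u @ [Inr b, Inr b'] @ v, u @ [Inr (b \<otimes>\<^bsub>H\<^esub> b')] @ v) \<in> fp_rel G H"

definition free_product ::
  "('a, 'c) monoid_scheme \<Rightarrow> ('b, 'd) monoid_scheme \<Rightarrow> ('a + 'b) list set monoid" where
  "free_product G H =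
    \<lparr>carrier = fp_words G H // fp_rel G H,
     mult = (\<lambda>A B. fp_rel G H `` {u @ v | u v. u \<in> A \<and> v \<in> B}),
     one = fp_rel G H `` {[]}\<rparr>"

definition fp_inl ::
  "('a, 'c) monoid_scheme \<Rightarrow> ('b, 'd) monoid_scheme \<Rightarrow> 'a \<Rightarrow> ('a + 'b) list set" where
  "fp_inl G H a = fp_rel G H `` {[Inl a]}"

definition fp_inr ::
  "('a, 'c) monoid_scheme \<Rightarrow> ('b, 'd) monoid_scheme \<Rightarrow> 'b \<Rightarrow> ('a + 'b) list set" where
  "fp_inr G H b = fp_rel G H `` {[Inr b]}"

primrec fp_word_value ::
  "('a, 'c) monoid_scheme \<Rightarrow> ('b, 'd) monoid_scheme \<Rightarrow> ('a + 'b) list \<Rightarrow> 'a \<times> 'b" where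
  "fp_word_value G H [] = \<one>\<^bsub>G \<times>\<times> H\<^esub>"
| "fp_word_value G H (x # w) =
    (case x of Inl a \<Rightarrow> (a, \<one>\<^bsub>H\<^esub>) | Inr b \<Rightarrow> (\<one>\<^bsub>G\<^esub>, b)) \<otimes>\<^bsub>G \<times>\<times> H\<^esub> fp_word_value G H w"

text \<open>The canonical projection from the free product onto the direct product. The value of a
  word depends only on its class, so the image of a class is a singleton.\<close>

definition fp_proj ::
  "('a, 'c) monoid_scheme \<Rightarrow> ('b, 'd) monoid_scheme \<Rightarrow> ('a + 'b) list set \<Rightarrow> 'a \<times> 'b" where
  "fp_proj G H A = the_elem (fp_word_value G H ` A)"

text \<open>The kernel of the canonical projection, as a group in its own right; this is the
  fundamental group of the fibre of the Denham--Suciu fibration.\<close>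

definition fibre_group ::
  "('a, 'c) monoid_scheme \<Rightarrow> ('b, 'd) monoid_scheme \<Rightarrow> ('a + 'b) list set monoid" where
  "fibre_group G H =
    (free_product G H)\<lparr>carrier := kernel (free_product G H) (G \<times>\<times> H) (fp_proj G H)\<rparr>"

definition fp_comm ::
  "('a, 'c) monoid_scheme \<Rightarrow> ('b, 'd) monoid_scheme \<Rightarrow>
    ('a + 'b) list set \<Rightarrow> ('a + 'b) list set \<Rightarrow> ('a + 'b) list set" where
  "fp_comm G H = commutator (free_product G H)"

section \<open>Bases of free groups\<close>

text \<open>A letter \<open>(s, True)\<close> stands for the generator \<open>s\<close>, and \<open>(s, False)\<close> for its inverse.\<close>

definition reduced_words :: "'a set \<Rightarrow> ('a \<times> bool) list set" where
  "reduced_words S =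
    {w \<in> lists (S \<times> UNIV). successively (\<lambda>(s, d) (t, e). s = t \<longrightarrow> d = e) w}"

primrec word_value :: "('a, 'c) monoid_scheme \<Rightarrow> ('a \<times> bool) list \<Rightarrow> 'a" where
  "word_value K [] = \<one>\<^bsub>K\<^esub>"
| "word_value K (x # w) = (if snd x then fst x else inv\<^bsub>K\<^esub> fst x) \<otimes>\<^bsub>K\<^esub> word_value K w"

definition free_basis :: "('a, 'c) monoid_scheme \<Rightarrow> 'a set \<Rightarrow> bool" where
  "free_basis K S \<longleftrightarrow>
    group K \<and> S \<subseteq> carrier K \<and> bij_betw (word_value K) (reduced_words S) (carrier K)"

section \<open>Outer automorphisms and the monodromy action\<close>

definition Inn :: "('a, 'c) monoid_scheme \<Rightarrow> ('a \<Rightarrow> 'a) set" where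
  "Inn K = (\<lambda>a. \<lambda>w\<in>carrier K. a \<otimes>\<^bsub>K\<^esub> w \<otimes>\<^bsub>K\<^esub> inv\<^bsub>K\<^esub> a) ` carrier K"

definition OutGroup :: "('a, 'c) monoid_scheme \<Rightarrow> ('a \<Rightarrow> 'a) set monoid" where
  "OutGroup K = AutoGroup K Mod Inn K"

definition outer_class :: "('a, 'c) monoid_scheme \<Rightarrow> ('a \<Rightarrow> 'a) \<Rightarrow> ('a \<Rightarrow> 'a) set" where
  "outer_class K \<alpha> = Inn K #>\<^bsub>AutoGroup K\<^esub> \<alpha>"

definition fibre_conj ::
  "('a, 'c) monoid_scheme \<Rightarrow> ('b, 'd) monoid_scheme \<Rightarrow>
    ('a + 'b) list set \<Rightarrow> ('a + 'b) list set \<Rightarrow> ('a + 'b) list set" where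
  "fibre_conj G H x = (\<lambda>w\<in>carrier (fibre_group G H).
     x \<otimes>\<^bsub>free_product G H\<^esub> w \<otimes>\<^bsub>free_product G H\<^esub> inv\<^bsub>free_product G H\<^esub> x)"

text \<open>The outer class of conjugation by a lift of \<open>t\<close> to the free product. Two lifts differ by
  an element of the kernel, so the class does not depend on the lift.\<close>

definition monodromy ::
  "('a, 'c) monoid_scheme \<Rightarrow> ('b, 'd) monoid_scheme \<Rightarrow> 'a \<times> 'b \<Rightarrow>
    (('a + 'b) list set \<Rightarrow> ('a + 'b) list set) set" where
  "monodromy G H t =
    the_elem ((\<lambda>x. outer_class (fibre_group G H) (fibre_conj G H x)) `
      {x \<in> carrier (free_product G H). fp_proj G H x = t})"

end

theory Submission
  imports Defs "HOL-Algebra.Elementary_Groups"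
begin

text \<open>
  Write \<open>P\<close> for the free product of \<open>G\<close> and \<open>H\<close>, \<open>F\<close> for the kernel of its projection to the direct
  product and \<open>[g, h]\<close> for the commutators. No normal form for elements of \<open>P\<close> is needed.

  Freeness. Every element of \<open>P\<close> is a product \<open>h g w\<close> with \<open>w\<close> in the subgroup generated by the
  commutators, because \<open>a h g = h (a g) [(a g)\<inverse>, h\<inverse>] [g\<inverse>, h\<inverse>]\<inverse>\<close>; applied to elements of the
  kernel, this shows that the commutators generate \<open>F\<close> (\<open>N_generated\<close>). The same formula, read as a
  definition, gives an action of \<open>P\<close> on \<open>G \<times> H \<times> A\<close> for any group \<open>A\<close> and any values \<open>\<sigma> g h\<close> in \<open>A\<close>
  with \<open>\<sigma> g 1 = \<sigma> 1 h = 1\<close>, and hence a homomorphism from \<open>F\<close> to \<open>A\<close> with \<open>[g, h] \<mapsto> \<sigma> g h\<close>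
  (\<open>fibre_universal\<close>). With the permutations of reduced words as \<open>A\<close>, this makes the commutators a free basis
  (\<open>free_basisI\<close>, \<open>fibre_free_basis\<close>).

  Monodromy. Conjugation is a homomorphism from \<open>P\<close> to the automorphism group of its normal subgroup
  \<open>F\<close>, and elements of \<open>F\<close> have trivial outer class; so the outer class of a conjugation depends only
  on the projection (\<open>conj_class_cong\<close>, \<open>monodromy_hom\<close>). The explicit equations are commutator
  identities, valid in every group.

  Faithfulness. With the integers as \<open>A\<close>, an element \<open>(g0, h0)\<close> with trivial outer class must leave
  invariant every homomorphism from \<open>F\<close> to the integers (\<open>trivial_class_invariant\<close>). On the
  abelianization of \<open>F\<close> it acts by
  \<open>[g, h] \<mapsto> [g0 g, h0 h] - [g0, h0 h] - [g0 g, h0] + [g0, h0]\<close>. If \<open>(g0, h0)\<close> is not the identity,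
  the first term is never \<open>[g, h]\<close>, so the diagonal entry at \<open>[g, h]\<close> can be positive only for
  \<open>(g, h) = (g0, h0)\<close>. Once the rank is at least two, some other diagonal entry differs from \<open>1\<close>
  (\<open>monodromy_faithful\<close>).
\<close>

section \<open>The free product as a group\<close>

locale two_groups = G: group G + H: group H
  for G :: "('a, 'c) monoid_scheme" and H :: "('b, 'd) monoid_scheme"
begin

text \<open>\<open>P\<close> is the free product, \<open>W\<close> the set of words that represent its elements, \<open>cls w\<close> the element
  represented by \<open>w\<close>, and \<open>\<iota>\<close>, \<open>\<kappa>\<close> are the inclusions of the factors.\<close>

abbreviation P where "P \<equiv> free_product G H"
abbreviation W where "W \<equiv> fp_words G H"
abbreviation cls where "cls w \<equiv> fp_rel G H `` {w}"
abbreviation \<iota> where "\<iota> \<equiv> fp_inl G H"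
abbreviation \<kappa> where "\<kappa> \<equiv> fp_inr G H"

lemma Nil_words [simp]: "[] \<in> W"
  and Cons_words [simp]: "x # w \<in> W \<longleftrightarrow> x \<in> carrier G <+> carrier H \<and> w \<in> W"
  and append_words [simp]: "u @ v \<in> W \<longleftrightarrow> u \<in> W \<and> v \<in> W"
  by (auto simp: fp_words_def)

lemma letter_in_carrier [simp]:
  "Inl a \<in> carrier G <+> carrier H \<longleftrightarrow> a \<in> carrier G"
  "Inr b \<in> carrier G <+> carrier H \<longleftrightarrow> b \<in> carrier H"
  by auto

lemma fp_rel_words: "(u, v) \<in> fp_rel G H \<Longrightarrow> u \<in> W \<and> v \<in> W"
  by (induction rule: fp_rel.induct) auto

lemma equiv_fp_rel: "equiv W (fp_rel G H)"
proof (rule equivI)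
  show "fp_rel G H \<subseteq> W \<times> W"
    using fp_rel_words by auto
  show "refl_on W (fp_rel G H)"
    by (rule refl_onI) (simp add: fp_rel.refl)
  show "sym (fp_rel G H)"
    by (auto intro: symI fp_rel.sym)
  show "trans (fp_rel G H)"
    by (auto intro: transI fp_rel.trans)
qed

lemma cls_eq: "(u, v) \<in> fp_rel G H \<Longrightarrow> cls u = cls v"
  by (rule equiv_class_eq[OF equiv_fp_rel])

lemma fp_rel_append_same:
  assumes "(u, v) \<in> fp_rel G H" "p \<in> W" "q \<in> W"
  shows "(p @ u @ q, p @ v @ q) \<in> fp_rel G H"
  using assms
proof (induction rule: fp_rel.induct)
  case (one_left u v)
  then show ?case using fp_rel.one_left[of "p @ u" G H "v @ q"] by simp
next
  case (one_right u v)
  then show ?case using fp_rel.one_right[of "p @ u" G H "v @ q"] by simp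
next
  case (mult_left u v a a')
  then show ?case using fp_rel.mult_left[of "p @ u" G H "v @ q" a a'] by simp
next
  case (mult_right u v b b')
  then show ?case using fp_rel.mult_right[of "p @ u" G H "v @ q" b b'] by simp
qed (auto intro: fp_rel.refl fp_rel.sym fp_rel.trans)

lemma fp_rel_append:
  assumes "(u, u') \<in> fp_rel G H" "(v, v') \<in> fp_rel G H"
  shows "(u @ v, u' @ v') \<in> fp_rel G H"
proof (rule fp_rel.trans)
  show "(u @ v, u' @ v) \<in> fp_rel G H"
    using fp_rel_append_same[OF assms(1), of "[]" v] fp_rel_words[OF assms(2)] by simp
  show "(u' @ v, u' @ v') \<in> fp_rel G H"
    using fp_rel_append_same[OF assms(2), of u' "[]"] fp_rel_words[OF assms(1)] by simp
qed

lemma carrier_P: "carrier P = cls ` W"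
  by (auto simp: free_product_def quotient_def)

lemma cls_in_P [simp]: "w \<in> W \<Longrightarrow> cls w \<in> carrier P"
  by (simp add: carrier_P)

lemma one_P: "\<one>\<^bsub>P\<^esub> = cls []"
  by (simp add: free_product_def)

lemma mult_P:
  assumes "u \<in> W" "v \<in> W"
  shows "cls u \<otimes>\<^bsub>P\<^esub> cls v = cls (u @ v)"
proof -
  have "(u @ v, x) \<in> fp_rel G H"
    if "(u, u') \<in> fp_rel G H" "(v, v') \<in> fp_rel G H" "(u' @ v', x) \<in> fp_rel G H" for u' v' x
    using that fp_rel_append fp_rel.trans by blast
  moreover have "(u, u) \<in> fp_rel G H" "(v, v) \<in> fp_rel G H"
    using assms by (auto intro: fp_rel.refl)
  ultimately show ?thesis
    by (fastforce simp: free_product_def)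
qed

lemma inl_closed [simp]: "a \<in> carrier G \<Longrightarrow> \<iota> a \<in> carrier P"
  and inr_closed [simp]: "b \<in> carrier H \<Longrightarrow> \<kappa> b \<in> carrier P"
  by (auto simp: fp_inl_def fp_inr_def)

lemma inl_one: "\<iota> \<one>\<^bsub>G\<^esub> = \<one>\<^bsub>P\<^esub>"
  using cls_eq[OF fp_rel.one_left[of "[]" G H "[]"]] by (simp add: fp_inl_def one_P)

lemma inr_one: "\<kappa> \<one>\<^bsub>H\<^esub> = \<one>\<^bsub>P\<^esub>"
  using cls_eq[OF fp_rel.one_right[of "[]" G H "[]"]] by (simp add: fp_inr_def one_P)

lemma inl_mult: "a \<in> carrier G \<Longrightarrow> a' \<in> carrier G \<Longrightarrow> \<iota> (a \<otimes>\<^bsub>G\<^esub> a') = \<iota> a \<otimes>\<^bsub>P\<^esub> \<iota> a'"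
  using cls_eq[OF fp_rel.mult_left[of "[]" G H "[]" a a']] by (simp add: fp_inl_def mult_P)

lemma inr_mult: "b \<in> carrier H \<Longrightarrow> b' \<in> carrier H \<Longrightarrow> \<kappa> (b \<otimes>\<^bsub>H\<^esub> b') = \<kappa> b \<otimes>\<^bsub>P\<^esub> \<kappa> b'"
  using cls_eq[OF fp_rel.mult_right[of "[]" G H "[]" b b']] by (simp add: fp_inr_def mult_P)

text \<open>Every element of the free product is obtained from the identity by finitely many left
  multiplications by letters.\<close>

lemma P_induct [consumes 1, case_names one left right]:
  assumes "x \<in> carrier P"
    and one: "Q \<one>\<^bsub>P\<^esub>"
    and left: "\<And>a y. a \<in> carrier G \<Longrightarrow> y \<in> carrier P \<Longrightarrow> Q y \<Longrightarrow> Q (\<iota> a \<otimes>\<^bsub>P\<^esub> y)"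
    and right: "\<And>b y. b \<in> carrier H \<Longrightarrow> y \<in> carrier P \<Longrightarrow> Q y \<Longrightarrow> Q (\<kappa> b \<otimes>\<^bsub>P\<^esub> y)"
  shows "Q x"
proof -
  have "Q (cls w)" if "w \<in> W" for w
    using that
  proof (induction w)
    case Nil
    then show ?case using one by (simp add: one_P)
  next
    case (Cons s w)
    then have w: "w \<in> W" "Q (cls w)" by auto
    show ?case
    proof (cases s)
      case (Inl a)
      with Cons.prems w left[of a "cls w"] show ?thesis
        by (simp add: fp_inl_def mult_P)
    next
      case (Inr b)
      with Cons.prems w right[of b "cls w"] show ?thesis
        by (simp add: fp_inr_def mult_P)
    qed
  qed
  then show ?thesis using assms(1) by (auto simp: carrier_P)
qed

lemma monoid_P: "monoid P"
  by (rule monoidI) (auto simp: carrier_P one_P mult_P simp del: Image_singleton_iff)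

lemma group_P: "group P"
proof -
  interpret P: monoid P by (rule monoid_P)
  have cancel: "y \<otimes>\<^bsub>P\<^esub> t \<otimes>\<^bsub>P\<^esub> (s \<otimes>\<^bsub>P\<^esub> x) = \<one>\<^bsub>P\<^esub>"
    if "y \<in> carrier P" "t \<in> carrier P" "s \<in> carrier P" "x \<in> carrier P"
      and "t \<otimes>\<^bsub>P\<^esub> s = \<one>\<^bsub>P\<^esub>" "y \<otimes>\<^bsub>P\<^esub> x = \<one>\<^bsub>P\<^esub>" for y t s x
  proof -
    have "y \<otimes>\<^bsub>P\<^esub> t \<otimes>\<^bsub>P\<^esub> (s \<otimes>\<^bsub>P\<^esub> x) = y \<otimes>\<^bsub>P\<^esub> ((t \<otimes>\<^bsub>P\<^esub> s) \<otimes>\<^bsub>P\<^esub> x)"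
      using that(1-4) by (simp add: P.m_assoc)
    then show ?thesis using that by simp
  qed
  have "\<exists>y\<in>carrier P. y \<otimes>\<^bsub>P\<^esub> x = \<one>\<^bsub>P\<^esub>" if "x \<in> carrier P" for x
    using that
  proof (induction rule: P_induct)
    case one
    show ?case by (intro bexI[of _ "\<one>\<^bsub>P\<^esub>"]) simp_all
  next
    case (left a y)
    then obtain z where z: "z \<in> carrier P" "z \<otimes>\<^bsub>P\<^esub> y = \<one>\<^bsub>P\<^esub>" by auto
    have "\<iota> (inv\<^bsub>G\<^esub> a) \<otimes>\<^bsub>P\<^esub> \<iota> a = \<one>\<^bsub>P\<^esub>"
      using left by (simp add: inl_one flip: inl_mult)
    then show ?case
      using left z by (intro bexI[of _ "z \<otimes>\<^bsub>P\<^esub> \<iota> (inv\<^bsub>G\<^esub> a)"] cancel) simp_all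
  next
    case (right b y)
    then obtain z where z: "z \<in> carrier P" "z \<otimes>\<^bsub>P\<^esub> y = \<one>\<^bsub>P\<^esub>" by auto
    have "\<kappa> (inv\<^bsub>H\<^esub> b) \<otimes>\<^bsub>P\<^esub> \<kappa> b = \<one>\<^bsub>P\<^esub>"
      using right by (simp add: inr_one flip: inr_mult)
    then show ?case
      using right z by (intro bexI[of _ "z \<otimes>\<^bsub>P\<^esub> \<kappa> (inv\<^bsub>H\<^esub> b)"] cancel) simp_all
  qed
  then show ?thesis by (intro P.group_l_invI) simp
qed

sublocale P: group P
  by (rule group_P)

lemma inl_hom: "\<iota> \<in> hom G P" and inr_hom: "\<kappa> \<in> hom H P"
  by (auto simp: hom_def inl_mult inr_mult)

lemma inl_inv: "a \<in> carrier G \<Longrightarrow> \<iota> (inv\<^bsub>G\<^esub> a) = inv\<^bsub>P\<^esub> \<iota> a"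
  using group_hom.hom_inv[of G P \<iota>] inl_hom
  by (simp add: group_hom_def group_hom_axioms_def group_P G.group_axioms)

lemma inr_inv: "b \<in> carrier H \<Longrightarrow> \<kappa> (inv\<^bsub>H\<^esub> b) = inv\<^bsub>P\<^esub> \<kappa> b"
  using group_hom.hom_inv[of H P \<kappa>] inr_hom
  by (simp add: group_hom_def group_hom_axioms_def group_P H.group_axioms)

subsection \<open>Actions of the free product\<close>

text \<open>An action of each factor on \<open>X\<close>, given letter by letter, makes equivalent words act equally.
  This is the universal property of the free product, stated for actions on a set.\<close>

lemma fp_rel_action:
  assumes "(u, v) \<in> fp_rel G H" and "x \<in> X"
    and closed: "\<And>s x. s \<in> carrier G <+> carrier H \<Longrightarrow> x \<in> X \<Longrightarrow> act s x \<in> X"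
    and one: "\<And>x. x \<in> X \<Longrightarrow> act (Inl \<one>\<^bsub>G\<^esub>) x = x" "\<And>x. x \<in> X \<Longrightarrow> act (Inr \<one>\<^bsub>H\<^esub>) x = x"
    and mult_G: "\<And>a a' x. a \<in> carrier G \<Longrightarrow> a' \<in> carrier G \<Longrightarrow> x \<in> X \<Longrightarrow>
      act (Inl a) (act (Inl a') x) = act (Inl (a \<otimes>\<^bsub>G\<^esub> a')) x"
    and mult_H: "\<And>b b' x. b \<in> carrier H \<Longrightarrow> b' \<in> carrier H \<Longrightarrow> x \<in> X \<Longrightarrow>
      act (Inr b) (act (Inr b') x) = act (Inr (b \<otimes>\<^bsub>H\<^esub> b')) x"
  shows "foldr act u x = foldr act v x"
proof -
  have fold: "foldr act w y \<in> X" if "w \<in> W" "y \<in> X" for w y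
    using that by (induction w) (auto intro!: closed)
  show ?thesis
    using assms(1)
  proof (induction rule: fp_rel.induct)
    case (one_left u v)
    then show ?case using assms(2) by (simp add: fold one)
  next
    case (one_right u v)
    then show ?case using assms(2) by (simp add: fold one)
  next
    case (mult_left u v a a')
    then show ?case using assms(2) by (simp add: fold mult_G)
  next
    case (mult_right u v b b')
    then show ?case using assms(2) by (simp add: fold mult_H)
  qed (blast | metis)+
qed

lemma action_extends:
  assumes closed: "\<And>s x. s \<in> carrier G <+> carrier H \<Longrightarrow> x \<in> X \<Longrightarrow> act s x \<in> X"
    and one: "\<And>x. x \<in> X \<Longrightarrow> act (Inl \<one>\<^bsub>G\<^esub>) x = x" "\<And>x. x \<in> X \<Longrightarrow> act (Inr \<one>\<^bsub>H\<^esub>) x = x"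
    and mult_G: "\<And>a a' x. a \<in> carrier G \<Longrightarrow> a' \<in> carrier G \<Longrightarrow> x \<in> X \<Longrightarrow>
      act (Inl a) (act (Inl a') x) = act (Inl (a \<otimes>\<^bsub>G\<^esub> a')) x"
    and mult_H: "\<And>b b' x. b \<in> carrier H \<Longrightarrow> b' \<in> carrier H \<Longrightarrow> x \<in> X \<Longrightarrow>
      act (Inr b) (act (Inr b') x) = act (Inr (b \<otimes>\<^bsub>H\<^esub> b')) x"
  obtains T where
    "\<And>x y. x \<in> carrier P \<Longrightarrow> y \<in> X \<Longrightarrow> T x y \<in> X"
    "\<And>y. y \<in> X \<Longrightarrow> T \<one>\<^bsub>P\<^esub> y = y"
    "\<And>x x' y. x \<in> carrier P \<Longrightarrow> x' \<in> carrier P \<Longrightarrow> y \<in> X \<Longrightarrow> T (x \<otimes>\<^bsub>P\<^esub> x') y = T x (T x' y)"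
    "\<And>a y. a \<in> carrier G \<Longrightarrow> y \<in> X \<Longrightarrow> T (\<iota> a) y = act (Inl a) y"
    "\<And>b y. b \<in> carrier H \<Longrightarrow> y \<in> X \<Longrightarrow> T (\<kappa> b) y = act (Inr b) y"
proof -
  define T where "T x y = foldr act (SOME w. w \<in> x) y" for x y
  have fold: "foldr act w y \<in> X" if "w \<in> W" "y \<in> X" for w y
    using that by (induction w) (auto intro!: closed)
  have T: "T (cls w) y = foldr act w y" if "w \<in> W" "y \<in> X" for w y
  proof -
    have "w \<in> cls w" using that by (auto intro: fp_rel.refl)
    then have "(w, SOME v. v \<in> cls w) \<in> fp_rel G H"
      by (metis Image_singleton_iff someI)
    then show ?thesis
      unfolding T_def
      by (intro fp_rel_action[of _ _ y X act, symmetric]) (use that assms in auto)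
  qed
  show ?thesis
    by (rule that[of T]) (auto simp: carrier_P one_P fp_inl_def fp_inr_def mult_P T fold simp del: Image_singleton_iff)
qed

subsection \<open>The projection onto the direct product\<close>

lemma fp_word_value_closed: "w \<in> W \<Longrightarrow> fp_word_value G H w \<in> carrier (G \<times>\<times> H)"
  by (induction w) (auto simp: mult_DirProd' mem_Times_iff split: sum.splits)

lemma fp_word_value_append:
  "u \<in> W \<Longrightarrow> v \<in> W \<Longrightarrow>
    fp_word_value G H (u @ v) = fp_word_value G H u \<otimes>\<^bsub>G \<times>\<times> H\<^esub> fp_word_value G H v"
proof (induction u)
  case (Cons s u)
  interpret GH: group "G \<times>\<times> H" by (rule DirProd_group[OF G.group_axioms H.group_axioms])
  have "(case s of Inl a \<Rightarrow> (a, \<one>\<^bsub>H\<^esub>) | Inr b \<Rightarrow> (\<one>\<^bsub>G\<^esub>, b)) \<in> carrier (G \<times>\<times> H)"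
    using Cons.prems by (auto split: sum.splits)
  with Cons show ?case
    using fp_word_value_closed[of u] fp_word_value_closed[of v] by (simp add: GH.m_assoc del: carrier_DirProd)
qed (use fp_word_value_closed in \<open>auto simp: mult_DirProd' mem_Times_iff\<close>)

lemma fp_proj_cls:
  assumes "w \<in> W"
  shows "fp_proj G H (cls w) = fp_word_value G H w"
proof -
  have "fp_word_value G H v = fp_word_value G H w" if "(w, v) \<in> fp_rel G H" for v
    using that
    by (induction rule: fp_rel.induct)
      (auto simp: fp_word_value_append mult_DirProd' G.m_assoc H.m_assoc
         dest!: fp_word_value_closed simp del: one_DirProd)
  moreover have "w \<in> cls w" using assms by (auto intro: fp_rel.refl)
  ultimately show ?thesis
    unfolding fp_proj_def by (intro the_elem_image_unique) blast+
qed

lemma proj_hom: "fp_proj G H \<in> hom P (G \<times>\<times> H)"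
  by (rule homI)
    (auto simp: carrier_P fp_proj_cls mult_P fp_word_value_append fp_word_value_closed 
      simp del: Image_singleton_iff carrier_DirProd)

lemma proj_inl: "a \<in> carrier G \<Longrightarrow> fp_proj G H (\<iota> a) = (a, \<one>\<^bsub>H\<^esub>)"
  and proj_inr: "b \<in> carrier H \<Longrightarrow> fp_proj G H (\<kappa> b) = (\<one>\<^bsub>G\<^esub>, b)"
  by (auto simp: fp_inl_def fp_inr_def fp_proj_cls)

end

section \<open>Commutator identities\<close>

lemma (in group) mult_inv_cancel:
  assumes "x \<in> carrier G" "y \<in> carrier G"
  shows "x \<otimes> (inv x \<otimes> y) = y" "inv x \<otimes> (x \<otimes> y) = y"
  using assms by (simp_all flip: m_assoc)

lemma (in group) commutator_closed:
  "x \<in> carrier G \<Longrightarrow> y \<in> carrier G \<Longrightarrow> commutator G x y \<in> carrier G"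
  by (simp add: commutator_def)

lemma (in group) conj_commutator_left:
  assumes "l \<in> carrier G" "x \<in> carrier G" "y \<in> carrier G"
  shows "l \<otimes> commutator G x y \<otimes> inv l = commutator G (l \<otimes> x) y \<otimes> commutator G y l"
  using assms by (simp add: commutator_def m_assoc inv_mult_group mult_inv_cancel)

lemma (in group) conj_commutator_right:
  assumes "l \<in> carrier G" "x \<in> carrier G" "y \<in> carrier G"
  shows "l \<otimes> commutator G x y \<otimes> inv l = commutator G l x \<otimes> commutator G x (l \<otimes> y)"
  using assms by (simp add: commutator_def m_assoc inv_mult_group mult_inv_cancel)

lemma (in group) inv_commutator:
  assumes "x \<in> carrier G" "y \<in> carrier G"
  shows "inv (commutator G x y) = commutator G y x"
  using assms by (simp add: commutator_def m_assoc inv_mult_group mult_inv_cancel)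

lemma (in group) commutator_one:
  assumes "x \<in> carrier G"
  shows "commutator G x \<one> = \<one>" "commutator G \<one> x = \<one>"
  using assms by (simp_all add: commutator_def)

section \<open>The kernel of the projection\<close>

context two_groups
begin

text \<open>\<open>F\<close> is the kernel of the projection as a group and \<open>N\<close> is its underlying set; \<open>c g h\<close> is the
  commutator of \<open>g\<close> and \<open>h\<close> in the free product.\<close>

abbreviation F where "F \<equiv> fibre_group G H"
abbreviation N where "N \<equiv> kernel P (G \<times>\<times> H) (fp_proj G H)"
abbreviation c where "c g h \<equiv> fp_comm G H (\<iota> g) (\<kappa> h)"

lemma group_GH: "group (G \<times>\<times> H)"
  by (rule DirProd_group[OF G.group_axioms H.group_axioms])

sublocale proj: group_hom P "G \<times>\<times> H" "fp_proj G H"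
  by (simp add: group_hom_def group_hom_axioms_def group_P group_GH proj_hom)

lemma F_simps [simp]:
  "carrier F = N" "x \<otimes>\<^bsub>F\<^esub> y = x \<otimes>\<^bsub>P\<^esub> y" "\<one>\<^bsub>F\<^esub> = \<one>\<^bsub>P\<^esub>"
  by (simp_all add: fibre_group_def)

lemma N_normal: "N \<lhd> P"
  by (rule proj.normal_kernel)

lemma N_subgroup: "subgroup N P"
  by (rule proj.subgroup_kernel)

lemma group_F: "group F"
  unfolding fibre_group_def by (rule P.subgroup_imp_group[OF N_subgroup])

lemma F_inv [simp]: "x \<in> N \<Longrightarrow> inv\<^bsub>F\<^esub> x = inv\<^bsub>P\<^esub> x"
  unfolding fibre_group_def by (rule P.m_inv_consistent[OF N_subgroup])

lemma c_closed [simp]: "g \<in> carrier G \<Longrightarrow> h \<in> carrier H \<Longrightarrow> c g h \<in> carrier P"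
  by (simp add: fp_comm_def P.commutator_closed)

lemma c_in_N [simp]: "g \<in> carrier G \<Longrightarrow> h \<in> carrier H \<Longrightarrow> c g h \<in> N"
  by (simp add: kernel_def) (simp add: fp_comm_def commutator_def proj_inl proj_inr inv_DirProd[OF G.group_axioms H.group_axioms])

lemma c_one: "h \<in> carrier H \<Longrightarrow> c \<one>\<^bsub>G\<^esub> h = \<one>\<^bsub>P\<^esub>" "g \<in> carrier G \<Longrightarrow> c g \<one>\<^bsub>H\<^esub> = \<one>\<^bsub>P\<^esub>"
  by (simp_all add: fp_comm_def inl_one inr_one P.commutator_one)

text \<open>The universal property of a free group on the commutators \<open>[g, h]\<close>: an assignment
  \<open>\<sigma>\<close> of values to them that is trivial on trivial commutators extends to a homomorphism. The free
  product acts on triples \<open>(g, h, y)\<close>, which stand for the elements \<open>h g y\<close> with \<open>y\<close> in the kernel;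
  the kernel fixes the first two coordinates, and \<open>\<Psi>\<close> is its effect on the third one over \<open>(1, 1)\<close>.\<close>

lemma fibre_universal:
  assumes A: "group A"
    and \<sigma>: "\<And>g h. g \<in> carrier G \<Longrightarrow> h \<in> carrier H \<Longrightarrow> \<sigma> g h \<in> carrier A"
    and \<sigma>_one: "\<And>h. h \<in> carrier H \<Longrightarrow> \<sigma> \<one>\<^bsub>G\<^esub> h = \<one>\<^bsub>A\<^esub>" "\<And>g. g \<in> carrier G \<Longrightarrow> \<sigma> g \<one>\<^bsub>H\<^esub> = \<one>\<^bsub>A\<^esub>"
  obtains \<Psi> where "\<Psi> \<in> hom F A"
    "\<And>g h. g \<in> carrier G \<Longrightarrow> h \<in> carrier H \<Longrightarrow> \<Psi> (c g h) = \<sigma> g h"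
proof -
  interpret A: group A by (rule A)
  \<comment> \<open>\<open>a h g y = h (a g) w y\<close>, where \<open>w = [(a g)\<inverse>, h\<inverse>] [g\<inverse>, h\<inverse>]\<inverse>\<close> lies in the kernel\<close>
  define \<tau> where "\<tau> g h = \<sigma> (inv\<^bsub>G\<^esub> g) (inv\<^bsub>H\<^esub> h)" for g h
  have \<tau>: "\<tau> g h \<in> carrier A" if "g \<in> carrier G" "h \<in> carrier H" for g h
    using that by (simp add: \<tau>_def \<sigma>)
  define act where "act s = (\<lambda>(g, h, y). case s of
      Inl a \<Rightarrow> (a \<otimes>\<^bsub>G\<^esub> g, h, \<tau> (a \<otimes>\<^bsub>G\<^esub> g) h \<otimes>\<^bsub>A\<^esub> (inv\<^bsub>A\<^esub> \<tau> g h \<otimes>\<^bsub>A\<^esub> y))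
    | Inr b \<Rightarrow> (g, b \<otimes>\<^bsub>H\<^esub> h, y))" for s
  let ?X = "carrier G \<times> carrier H \<times> carrier A"
  obtain T where
    T_one: "\<And>y. y \<in> ?X \<Longrightarrow> T \<one>\<^bsub>P\<^esub> y = y" and
    T_mult: "\<And>x x' y. x \<in> carrier P \<Longrightarrow> x' \<in> carrier P \<Longrightarrow> y \<in> ?X \<Longrightarrow>
      T (x \<otimes>\<^bsub>P\<^esub> x') y = T x (T x' y)" and
    T_left: "\<And>a y. a \<in> carrier G \<Longrightarrow> y \<in> ?X \<Longrightarrow> T (\<iota> a) y = act (Inl a) y" and
    T_right: "\<And>b y. b \<in> carrier H \<Longrightarrow> y \<in> ?X \<Longrightarrow> T (\<kappa> b) y = act (Inr b) y"
    by (rule action_extends[of ?X act])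
      (auto simp: act_def \<tau> A.mult_inv_cancel G.m_assoc H.m_assoc)
  \<comment> \<open>The action commutes with right multiplication on the third coordinate.\<close>
  have shift: "\<exists>z\<in>carrier A. \<forall>y\<in>carrier A.
      T x (g, h, y) = (fst (fp_proj G H x) \<otimes>\<^bsub>G\<^esub> g, snd (fp_proj G H x) \<otimes>\<^bsub>H\<^esub> h, z \<otimes>\<^bsub>A\<^esub> y)"
    if "x \<in> carrier P" "g \<in> carrier G" "h \<in> carrier H" for x g h
    using that(1)
  proof (induction rule: P_induct)
    case one
    show ?case using that(2,3) by (intro bexI[of _ "\<one>\<^bsub>A\<^esub>"]) (simp_all add: T_one)
  next
    case (left a x)
    let ?g = "fst (fp_proj G H x)" and ?h = "snd (fp_proj G H x)"
    have p: "?g \<in> carrier G" "?h \<in> carrier H"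
      using proj.hom_closed[OF left(2)] by (auto simp: mem_Times_iff)
    from left obtain z where z: "z \<in> carrier A"
      "\<And>y. y \<in> carrier A \<Longrightarrow> T x (g, h, y) = (?g \<otimes>\<^bsub>G\<^esub> g, ?h \<otimes>\<^bsub>H\<^esub> h, z \<otimes>\<^bsub>A\<^esub> y)" by auto
    show ?case
      using left(1,2) p z that(2,3)
      by (intro bexI[of _ "\<tau> (a \<otimes>\<^bsub>G\<^esub> (?g \<otimes>\<^bsub>G\<^esub> g)) (?h \<otimes>\<^bsub>H\<^esub> h) \<otimes>\<^bsub>A\<^esub> (inv\<^bsub>A\<^esub> \<tau> (?g \<otimes>\<^bsub>G\<^esub> g) (?h \<otimes>\<^bsub>H\<^esub> h) \<otimes>\<^bsub>A\<^esub> z)"])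
        (simp_all add: T_mult T_left act_def mult_DirProd' proj_inl \<tau> A.m_assoc G.m_assoc)
  next
    case (right b x)
    let ?g = "fst (fp_proj G H x)" and ?h = "snd (fp_proj G H x)"
    have p: "?g \<in> carrier G" "?h \<in> carrier H"
      using proj.hom_closed[OF right(2)] by (auto simp: mem_Times_iff)
    from right obtain z where z: "z \<in> carrier A"
      "\<And>y. y \<in> carrier A \<Longrightarrow> T x (g, h, y) = (?g \<otimes>\<^bsub>G\<^esub> g, ?h \<otimes>\<^bsub>H\<^esub> h, z \<otimes>\<^bsub>A\<^esub> y)" by auto
    show ?case
      using right(1,2) p z that(2,3)
      by (intro bexI[of _ z]) (simp_all add: T_mult T_right act_def mult_DirProd' proj_inr H.m_assoc)
  qed
  have "\<exists>z\<in>carrier A. \<forall>y\<in>carrier A. T x (\<one>\<^bsub>G\<^esub>, \<one>\<^bsub>H\<^esub>, y) = (\<one>\<^bsub>G\<^esub>, \<one>\<^bsub>H\<^esub>, z \<otimes>\<^bsub>A\<^esub> y)"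
    if "x \<in> N" for x
    using shift[of x "\<one>\<^bsub>G\<^esub>" "\<one>\<^bsub>H\<^esub>"] that by (simp add: kernel_def)
  then obtain \<Psi> where \<Psi>: "\<And>x. x \<in> N \<Longrightarrow> \<Psi> x \<in> carrier A"
    "\<And>x y. x \<in> N \<Longrightarrow> y \<in> carrier A \<Longrightarrow>
      T x (\<one>\<^bsub>G\<^esub>, \<one>\<^bsub>H\<^esub>, y) = (\<one>\<^bsub>G\<^esub>, \<one>\<^bsub>H\<^esub>, \<Psi> x \<otimes>\<^bsub>A\<^esub> y)"
    by metis
  have \<Psi>_eqI: "\<Psi> x = z" if "x \<in> N" "z \<in> carrier A"
    "T x (\<one>\<^bsub>G\<^esub>, \<one>\<^bsub>H\<^esub>, \<one>\<^bsub>A\<^esub>) = (\<one>\<^bsub>G\<^esub>, \<one>\<^bsub>H\<^esub>, z)" for x z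
    using \<Psi>[of x] \<Psi>(2)[of x "\<one>\<^bsub>A\<^esub>"] that by simp
  show thesis
  proof (rule that[of \<Psi>])
    show "\<Psi> \<in> hom F A"
    proof (rule homI)
      fix x y assume xy: "x \<in> carrier F" "y \<in> carrier F"
      then have "x \<in> carrier P" "y \<in> carrier P" "x \<otimes>\<^bsub>P\<^esub> y \<in> N"
        using subgroup.m_closed[OF N_subgroup] by (auto simp: kernel_def)
      moreover have "\<Psi> x \<in> carrier A" "\<Psi> y \<in> carrier A"
        using xy \<Psi>(1) by auto
      ultimately have "\<Psi> (x \<otimes>\<^bsub>P\<^esub> y) = \<Psi> x \<otimes>\<^bsub>A\<^esub> \<Psi> y"
        using xy \<Psi>(2)[of y "\<one>\<^bsub>A\<^esub>"] \<Psi>(2)[of x "\<Psi> y"]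
        by (intro \<Psi>_eqI) (simp_all add: T_mult)
      then show "\<Psi> (x \<otimes>\<^bsub>F\<^esub> y) = \<Psi> x \<otimes>\<^bsub>A\<^esub> \<Psi> y" by simp
    qed (simp add: \<Psi>)
    fix g h assume gh: "g \<in> carrier G" "h \<in> carrier H"
    have "c g h = \<iota> g \<otimes>\<^bsub>P\<^esub> (\<kappa> h \<otimes>\<^bsub>P\<^esub> (\<iota> (inv\<^bsub>G\<^esub> g) \<otimes>\<^bsub>P\<^esub> \<kappa> (inv\<^bsub>H\<^esub> h)))"
      using gh by (simp add: fp_comm_def commutator_def inl_inv inr_inv P.m_assoc)
    with gh have "T (c g h) (\<one>\<^bsub>G\<^esub>, \<one>\<^bsub>H\<^esub>, \<one>\<^bsub>A\<^esub>) = (\<one>\<^bsub>G\<^esub>, \<one>\<^bsub>H\<^esub>, \<sigma> g h)"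
      by (simp add: T_mult T_left T_right act_def \<sigma> \<tau>_def \<sigma>_one)
    with gh show "\<Psi> (c g h) = \<sigma> g h"
      by (intro \<Psi>_eqI) (simp_all add: \<sigma>)
  qed
qed

lemma N_generated:
  "N = generate P {c g h | g h. g \<in> carrier G - {\<one>\<^bsub>G\<^esub>} \<and> h \<in> carrier H - {\<one>\<^bsub>H\<^esub>}}"
    (is "N = generate P ?B")
proof
  have B: "?B \<subseteq> N" by auto
  then show "generate P ?B \<subseteq> N"
    by (rule P.generate_subgroup_incl[OF _ N_subgroup])
  have BP: "?B \<subseteq> carrier P" by auto
  let ?M = "generate P ?B"
  have M: "subgroup ?M P" by (rule P.generate_is_subgroup[OF BP])
  have cM: "c g h \<in> ?M" if "g \<in> carrier G" "h \<in> carrier H" for g h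
  proof (cases "g = \<one>\<^bsub>G\<^esub> \<or> h = \<one>\<^bsub>H\<^esub>")
    case True
    then show ?thesis using that by (auto simp: c_one intro: generate.one)
  next
    case False
    then show ?thesis using that by (auto intro!: generate.incl)
  qed
  \<comment> \<open>The products \<open>h g w\<close> with \<open>w\<close> generated by commutators absorb letters from the left.\<close>
  have form: "\<exists>g\<in>carrier G. \<exists>h\<in>carrier H. \<exists>w\<in>?M. x = \<kappa> h \<otimes>\<^bsub>P\<^esub> (\<iota> g \<otimes>\<^bsub>P\<^esub> w)"
    if "x \<in> carrier P" for x
    using that
  proof (induction rule: P_induct)
    case one
    show ?case
      by (intro bexI[of _ "\<one>\<^bsub>G\<^esub>"] bexI[of _ "\<one>\<^bsub>H\<^esub>"] bexI[of _ "\<one>\<^bsub>P\<^esub>"])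
        (simp_all add: inl_one inr_one generate.one)
  next
    case (left a x)
    then obtain g h w where x: "g \<in> carrier G" "h \<in> carrier H" "w \<in> ?M"
      "x = \<kappa> h \<otimes>\<^bsub>P\<^esub> (\<iota> g \<otimes>\<^bsub>P\<^esub> w)" by auto
    have w: "w \<in> carrier P" using x(3) subgroup.subset[OF M] by auto
    let ?d = "c (inv\<^bsub>G\<^esub> (a \<otimes>\<^bsub>G\<^esub> g)) (inv\<^bsub>H\<^esub> h) \<otimes>\<^bsub>P\<^esub> (inv\<^bsub>P\<^esub> c (inv\<^bsub>G\<^esub> g) (inv\<^bsub>H\<^esub> h) \<otimes>\<^bsub>P\<^esub> w)"
    have "\<iota> a \<otimes>\<^bsub>P\<^esub> x = \<kappa> h \<otimes>\<^bsub>P\<^esub> (\<iota> (a \<otimes>\<^bsub>G\<^esub> g) \<otimes>\<^bsub>P\<^esub> ?d)"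
      using left(1) x(1,2) w
      by (simp add: x(4) fp_comm_def P.inv_commutator commutator_def inl_inv inr_inv inl_mult
          P.m_assoc P.inv_mult_group P.mult_inv_cancel G.inv_mult_group)
    moreover have "?d \<in> ?M"
      using left(1) x by (intro subgroup.m_closed[OF M] subgroup.m_inv_closed[OF M] cM) simp_all
    ultimately show ?case using left(1) x(1,2) by blast
  next
    case (right b x)
    then obtain g h w where x: "g \<in> carrier G" "h \<in> carrier H" "w \<in> ?M"
      "x = \<kappa> h \<otimes>\<^bsub>P\<^esub> (\<iota> g \<otimes>\<^bsub>P\<^esub> w)" by auto
    have w: "w \<in> carrier P" using x(3) subgroup.subset[OF M] by auto
    have "\<kappa> b \<otimes>\<^bsub>P\<^esub> x = \<kappa> (b \<otimes>\<^bsub>H\<^esub> h) \<otimes>\<^bsub>P\<^esub> (\<iota> g \<otimes>\<^bsub>P\<^esub> w)"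
      using right(1) x(1,2) w by (simp add: x(4) inr_mult P.m_assoc)
    then show ?case using right(1) x(1,2,3) H.m_closed by blast
  qed
  show "N \<subseteq> ?M"
  proof
    fix x assume x: "x \<in> N"
    then obtain g h w where gh: "g \<in> carrier G" "h \<in> carrier H" "w \<in> ?M"
      and eq: "x = \<kappa> h \<otimes>\<^bsub>P\<^esub> (\<iota> g \<otimes>\<^bsub>P\<^esub> w)"
      using form[of x] by (auto simp: kernel_def)
    have "w \<in> N" using gh(3) \<open>?M \<subseteq> N\<close> by auto
    then have w: "w \<in> carrier P" "fp_proj G H w = (\<one>\<^bsub>G\<^esub>, \<one>\<^bsub>H\<^esub>)" by (auto simp: kernel_def)
    have "fp_proj G H x = (g, h)"
      using gh(1,2) w by (simp add: eq proj_inl proj_inr)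
    then have "g = \<one>\<^bsub>G\<^esub>" "h = \<one>\<^bsub>H\<^esub>" using x by (auto simp: kernel_def)
    then show "x \<in> ?M" using gh(3) w by (simp add: eq inl_one inr_one)
  qed
qed

end

section \<open>Free bases and reduced words\<close>

text \<open>Left multiplication of a reduced word by a letter, followed by cancellation if the new letter
  is inverse to the first one. On reduced words this is the left regular action of a free group,
  so that it can be used without a construction of that group.\<close>

definition push :: "'i \<times> bool \<Rightarrow> ('i \<times> bool) list \<Rightarrow> ('i \<times> bool) list" where
  "push l w = (if w \<noteq> [] \<and> hd w = (fst l, \<not> snd l) then tl w else l # w)"

lemma Nil_reduced [simp]: "[] \<in> reduced_words I"
  by (simp add: reduced_words_def)

lemma Cons_reduced:
  "l # w \<in> reduced_words I \<longleftrightarrow>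
     fst l \<in> I \<and> w \<in> reduced_words I \<and> (w \<noteq> [] \<longrightarrow> hd w \<noteq> (fst l, \<not> snd l))"
  by (cases w; cases l) (auto simp: reduced_words_def)

lemma push_reduced: "fst l \<in> I \<Longrightarrow> w \<in> reduced_words I \<Longrightarrow> push l w \<in> reduced_words I"
  by (cases w) (auto simp: push_def Cons_reduced)

lemma push_eq_Cons: "l # w \<in> reduced_words I \<Longrightarrow> push l w = l # w"
  by (auto simp: push_def Cons_reduced)

lemma push_push_inverse:
  "w \<in> reduced_words I \<Longrightarrow> push (i, d) (push (i, \<not> d) w) = w"
  by (cases w) (auto simp: push_def Cons_reduced)

lemma push_Bij:
  assumes "i \<in> I"
  shows "restrict (push (i, d)) (reduced_words I) \<in> Bij (reduced_words I)"
proof -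
  have "bij_betw (push (i, d)) (reduced_words I) (reduced_words I)"
    by (rule bij_betw_byWitness[where f' = "push (i, \<not> d)"])
      (use assms push_push_inverse[of _ I i d] push_push_inverse[of _ I i "\<not> d"]
        in \<open>auto intro: push_reduced\<close>)
  then show ?thesis by (simp add: Bij_def bij_betw_restrict_eq)
qed

lemma reduced_words_image:
  assumes "inj_on f I"
  shows "reduced_words (f ` I) = map (apfst f) ` reduced_words I"
proof -
  have succ: "successively (\<lambda>(s, d) (t, e). s = t \<longrightarrow> d = e) (map (apfst f) w) \<longleftrightarrow>
      successively (\<lambda>(s, d) (t, e). s = t \<longrightarrow> d = e) w" if "w \<in> lists (I \<times> (UNIV :: bool set))" for w
    unfolding successively_map
    by (rule successively_cong) (use that inj_on_eq_iff[OF assms] in \<open>fastforce simp: in_lists_conv_set\<close>)+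
  have "f ` I \<times> UNIV = apfst f ` (I \<times> (UNIV :: bool set))"
    by force
  then have lists: "lists (f ` I \<times> (UNIV :: bool set)) = map (apfst f) ` lists (I \<times> UNIV)"
    by (simp add: lists_image)
  show ?thesis
  proof (intro equalityI subsetI)
    fix w assume "w \<in> reduced_words (f ` I)"
    then obtain v where "v \<in> lists (I \<times> UNIV)" "w = map (apfst f) v"
      and "successively (\<lambda>(s, d) (t, e). s = t \<longrightarrow> d = e) w"
      unfolding reduced_words_def lists by blast
    then show "w \<in> map (apfst f) ` reduced_words I"
      using succ[of v] by (simp add: reduced_words_def)
  next
    fix w assume "w \<in> map (apfst f) ` reduced_words I"
    then obtain v where "v \<in> lists (I \<times> UNIV)" "w = map (apfst f) v"
      and "successively (\<lambda>(s, d) (t, e). s = t \<longrightarrow> d = e) v"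
      unfolding reduced_words_def by blast
    then show "w \<in> reduced_words (f ` I)"
      using succ[of v] unfolding reduced_words_def lists by blast
  qed
qed

text \<open>A generating family is a free basis as soon as the group acts on reduced words in such a way
  that the members of the family push their letter: applied to the empty word, the value of a
  reduced word gives the word back.\<close>

lemma (in group) free_basisI:
  assumes f: "\<And>i. i \<in> I \<Longrightarrow> f i \<in> carrier G"
    and gen: "carrier G = generate G (f ` I)"
    and \<Psi>: "\<Psi> \<in> hom G (BijGroup (reduced_words I))"
    and \<Psi>_f: "\<And>i. i \<in> I \<Longrightarrow> \<Psi> (f i) = restrict (push (i, True)) (reduced_words I)"
  shows "free_basis G (f ` I)" and "inj_on f I"
proof -
  let ?R = "reduced_words I"
  interpret B: group "BijGroup ?R" by (rule group_BijGroup)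
  interpret \<Psi>: group_hom G "BijGroup ?R" \<Psi>
    by (simp add: group_hom_def group_hom_axioms_def group_axioms B.group_axioms \<Psi>)
  let ?e = "\<lambda>i d. if d then f i else inv f i"
  define val where "val w = word_value G (map (apfst f) w)" for w
  have val_Cons: "val ((i, d) # w) = ?e i d \<otimes> val w" for i d w
    by (simp add: val_def)
  have e: "?e i d \<in> carrier G" if "i \<in> I" for i d
    using that f by simp
  have val: "val w \<in> carrier G" if "w \<in> ?R" for w
    using that by (induction w) (auto simp: val_def Cons_reduced f)
  have \<Psi>_e: "\<Psi> (?e i d) = restrict (push (i, d)) ?R" if i: "i \<in> I" for i d
  proof (cases d)
    case True
    then show ?thesis using \<Psi>_f[OF i] by simp
  next
    case False
    have "inv\<^bsub>BijGroup ?R\<^esub> (restrict (push (i, True)) ?R) = restrict (push (i, False)) ?R"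
    proof (rule B.inv_equality)
      show "restrict (push (i, False)) ?R \<otimes>\<^bsub>BijGroup ?R\<^esub> restrict (push (i, True)) ?R
          = \<one>\<^bsub>BijGroup ?R\<^esub>"
        using push_Bij[OF i] push_push_inverse[of _ I i False] push_reduced[of "(i, True)" I] i
        by (auto simp: BijGroup_def compose_def fun_eq_iff)
    qed (use push_Bij[OF i] in \<open>simp_all add: BijGroup_def\<close>)
    then show ?thesis using False \<Psi>_f[OF i] f[OF i] by simp
  qed
  have \<Psi>_mult: "\<Psi> (x \<otimes> y) w = \<Psi> x (\<Psi> y w)"
    if "x \<in> carrier G" "y \<in> carrier G" "w \<in> ?R" for x y w
  proof -
    have "\<Psi> x \<in> Bij ?R" "\<Psi> y \<in> Bij ?R"
      using \<Psi>.hom_closed that by (simp_all add: BijGroup_def)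
    then show ?thesis using that by (simp add: BijGroup_def compose_def)
  qed
  have \<Psi>_val: "\<Psi> (val w) [] = w" if "w \<in> ?R" for w
    using that
  proof (induction w)
    case Nil
    have "\<Psi> \<one> = \<one>\<^bsub>BijGroup ?R\<^esub>" by (rule \<Psi>.hom_one)
    then show ?case by (simp add: val_def BijGroup_def)
  next
    case (Cons l w)
    obtain i d where l: "l = (i, d)" by (cases l)
    have iw: "i \<in> I" "w \<in> ?R" using Cons.prems by (auto simp: l Cons_reduced)
    then have "\<Psi> (val (l # w)) [] = \<Psi> (?e i d) w"
      using Cons.IH e[OF iw(1)] val[OF iw(2)] by (simp only: l val_Cons \<Psi>_mult Nil_reduced)
    also have "\<dots> = push l w"
      unfolding \<Psi>_e[OF iw(1)] l using iw by simp
    finally show ?case using push_eq_Cons[OF Cons.prems] by simp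
  qed
  have inj_val: "inj_on val ?R"
    by (rule inj_on_inverseI[where g = "\<lambda>x. \<Psi> x []"]) (rule \<Psi>_val)
  have e_inverse: "?e i d \<otimes> (?e i (\<not> d) \<otimes> y) = y" if "i \<in> I" "y \<in> carrier G" for i d y
    using that f by (simp add: mult_inv_cancel)
  have val_push: "val (push (i, d) w) = ?e i d \<otimes> val w" if "i \<in> I" "w \<in> ?R" for i d w
  proof (cases "\<exists>w'. w = (i, \<not> d) # w'")
    case True
    then obtain w' where w': "w = (i, \<not> d) # w'" by blast
    then have "val w' \<in> carrier G" using that val by (auto simp: Cons_reduced)
    then show ?thesis using e_inverse[OF that(1)] by (simp only: w' val_Cons push_def) simp
  next
    case False
    then have "push (i, d) w = (i, d) # w" by (cases w) (auto simp: push_def)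
    then show ?thesis by (simp only: val_Cons)
  qed
  have step: "\<exists>w'\<in>?R. x \<otimes> val w = val w'" if "x \<in> generate G (f ` I)" "w \<in> ?R" for x w
    using that
  proof (induction arbitrary: w rule: generate.induct)
    case one
    then show ?case using val by (intro bexI[of _ w]) simp_all
  next
    case (incl h)
    then obtain i where "i \<in> I" "h = f i" by auto
    then show ?case
      using incl val_push[of i w True] push_reduced[of "(i, True)" I w]
      by (intro bexI[of _ "push (i, True) w"]) simp_all
  next
    case (inv h)
    then obtain i where "i \<in> I" "h = f i" by auto
    then show ?case
      using inv val_push[of i w False] push_reduced[of "(i, False)" I w]
      by (intro bexI[of _ "push (i, False) w"]) simp_all
  next
    case (eng h1 h2)
    then obtain w2 where w2: "w2 \<in> ?R" "h2 \<otimes> val w = val w2" by blast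
    then obtain w1 where w1: "w1 \<in> ?R" "h1 \<otimes> val w2 = val w1" using eng.IH(1) by blast
    have "h1 \<in> carrier G" "h2 \<in> carrier G" using eng.hyps gen by auto
    then have "h1 \<otimes> h2 \<otimes> val w = val w1"
      using w1 w2 val[OF eng.prems] by (simp add: m_assoc)
    then show ?case using w1(1) by blast
  qed
  have "x \<in> val ` ?R" if "x \<in> carrier G" for x
    using step[of x "[]"] that gen by (auto simp: val_def)
  then have bij: "bij_betw val ?R (carrier G)"
    using inj_val val by (auto simp: bij_betw_def)
  show inj_f: "inj_on f I"
  proof (rule inj_onI)
    fix i j assume ij: "i \<in> I" "j \<in> I" "f i = f j"
    then have "val [(i, True)] = val [(j, True)]" by (simp add: val_def)
    then have "[(i, True)] = [(j, True)]"
      by (rule inj_onD[OF inj_val]) (use ij in \<open>simp_all add: Cons_reduced\<close>)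
    then show "i = j" by simp
  qed
  have "inj_on (word_value G) (reduced_words (f ` I))"
    unfolding reduced_words_image[OF inj_f]
    by (rule inj_on_imageI) (use inj_val in \<open>simp add: comp_def flip: val_def\<close>)
  moreover have "word_value G ` reduced_words (f ` I) = carrier G"
    unfolding reduced_words_image[OF inj_f] using bij by (simp add: image_image bij_betw_def val_def)
  ultimately show "free_basis G (f ` I)"
    using f by (auto simp: free_basis_def group_axioms bij_betw_def)
qed

context two_groups
begin

text \<open>The index set of the nontrivial commutators.\<close>

abbreviation I where "I \<equiv> (carrier G - {\<one>\<^bsub>G\<^esub>}) \<times> (carrier H - {\<one>\<^bsub>H\<^esub>})"

lemma fibre_free_basis: "free_basis F (case_prod c ` I)"
  and inj_c: "inj_on (case_prod c) I"
proof -
  let ?R = "reduced_words I"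
  interpret B: group "BijGroup ?R" by (rule group_BijGroup)
  interpret F: group F by (rule group_F)
  obtain \<Psi> where \<Psi>: "\<Psi> \<in> hom F (BijGroup ?R)"
    "\<And>g h. g \<in> carrier G \<Longrightarrow> h \<in> carrier H \<Longrightarrow>
      \<Psi> (c g h) = (if (g, h) \<in> I then restrict (push ((g, h), True)) ?R else \<one>\<^bsub>BijGroup ?R\<^esub>)"
  proof (rule fibre_universal[of "BijGroup ?R" "\<lambda>g h.
      if (g, h) \<in> I then restrict (push ((g, h), True)) ?R else \<one>\<^bsub>BijGroup ?R\<^esub>"])
    fix g h assume "g \<in> carrier G" "h \<in> carrier H"
    have "(g, h) \<in> I \<Longrightarrow> restrict (push ((g, h), True)) ?R \<in> carrier (BijGroup ?R)"
      using push_Bij[of "(g, h)" I True] by (simp add: BijGroup_def)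
    then show "(if (g, h) \<in> I then restrict (push ((g, h), True)) ?R else \<one>\<^bsub>BijGroup ?R\<^esub>)
        \<in> carrier (BijGroup ?R)"
      by (simp del: mem_Sigma_iff)
  qed (simp_all add: B.group_axioms)
  have "case_prod c ` I = {c g h | g h. g \<in> carrier G - {\<one>\<^bsub>G\<^esub>} \<and> h \<in> carrier H - {\<one>\<^bsub>H\<^esub>}}"
    by force
  then have "N = generate P (case_prod c ` I)"
    using N_generated by (simp only:)
  moreover have "generate F (case_prod c ` I) = generate P (case_prod c ` I)"
    unfolding fibre_group_def by (rule P.generate_consistent[OF _ N_subgroup]) auto
  ultimately have gen: "carrier F = generate F (case_prod c ` I)"
    by (simp only: F_simps)
  have im: "case_prod c i \<in> carrier F" if "i \<in> I" for i
    using that by auto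
  have act: "\<Psi> (case_prod c i) = restrict (push (i, True)) ?R" if "i \<in> I" for i
    using that \<Psi>(2)[of "fst i" "snd i"] by (auto simp: split_beta)
  show "free_basis F (case_prod c ` I)" "inj_on (case_prod c) I"
    using F.free_basisI[of I "case_prod c", OF im gen \<Psi>(1) act] by blast+
qed

end

section \<open>Outer automorphisms\<close>

lemma (in group) normal_conj_hom:
  assumes "N \<lhd> G"
  shows "(\<lambda>x. \<lambda>w\<in>N. x \<otimes> w \<otimes> inv x) \<in> hom G (AutoGroup (G\<lparr>carrier := N\<rparr>))"
proof (rule homI)
  interpret N: normal N G by (rule assms)
  have conj_in: "x \<otimes> w \<otimes> inv x \<in> N" if "x \<in> carrier G" "w \<in> N" for x w
    using that by (rule N.inv_op_closed2)
  show closed: "(\<lambda>w\<in>N. x \<otimes> w \<otimes> inv x) \<in> carrier (AutoGroup (G\<lparr>carrier := N\<rparr>))"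
    if x: "x \<in> carrier G" for x
  proof -
    have "bij_betw (\<lambda>w. x \<otimes> w \<otimes> inv x) N N"
      by (rule bij_betw_byWitness[where f' = "\<lambda>w. inv x \<otimes> w \<otimes> x"])
        (use x conj_in[OF x] N.inv_op_closed1 in \<open>auto simp: m_assoc mult_inv_cancel\<close>)
    moreover have "(\<lambda>w\<in>N. x \<otimes> w \<otimes> inv x) \<in> hom (G\<lparr>carrier := N\<rparr>) (G\<lparr>carrier := N\<rparr>)"
      using x conj_in by (intro homI) (simp_all add: m_assoc mult_inv_cancel)
    ultimately show ?thesis
      by (simp add: AutoGroup_def auto_def Bij_def bij_betw_restrict_eq)
  qed
  fix x y assume xy: "x \<in> carrier G" "y \<in> carrier G"
  have "(\<lambda>w\<in>N. z \<otimes> w \<otimes> inv z) \<in> Bij N" if "z \<in> carrier G" for z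
    using closed[OF that] by (simp add: AutoGroup_def auto_def)
  then show "(\<lambda>w\<in>N. x \<otimes> y \<otimes> w \<otimes> inv (x \<otimes> y)) =
      (\<lambda>w\<in>N. x \<otimes> w \<otimes> inv x) \<otimes>\<^bsub>AutoGroup (G\<lparr>carrier := N\<rparr>)\<^esub> (\<lambda>w\<in>N. y \<otimes> w \<otimes> inv y)"
    using xy conj_in by (auto simp: AutoGroup_def BijGroup_def compose_def fun_eq_iff m_assoc inv_mult_group)
qed

lemma (in group) self_normal: "carrier G \<lhd> G"
  by (simp add: normal_inv_iff subgroup_self)

lemma (in group) inner_hom:
  "(\<lambda>a. \<lambda>w\<in>carrier G. a \<otimes> w \<otimes> inv a) \<in> hom G (AutoGroup G)"
  using normal_conj_hom[OF self_normal] by simp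

lemma (in group) Inn_normal: "Inn G \<lhd> AutoGroup G"
proof -
  interpret A: group "AutoGroup G" by (rule AutoGroup)
  let ?inner = "\<lambda>a. \<lambda>w\<in>carrier G. a \<otimes> w \<otimes> inv a"
  interpret inner: group_hom G "AutoGroup G" ?inner
    by (simp add: group_hom_def group_hom_axioms_def group_axioms A.group_axioms inner_hom)
  have "?inner ` carrier G = Inn G" by (simp add: Inn_def)
  then have sub: "subgroup (Inn G) (AutoGroup G)"
    using inner.img_is_subgroup by metis
  have "\<alpha> \<otimes>\<^bsub>AutoGroup G\<^esub> \<beta> \<otimes>\<^bsub>AutoGroup G\<^esub> inv\<^bsub>AutoGroup G\<^esub> \<alpha> \<in> Inn G"
    if \<alpha>: "\<alpha> \<in> carrier (AutoGroup G)" and \<beta>: "\<beta> \<in> Inn G" for \<alpha> \<beta>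
  proof -
    obtain a where a: "a \<in> carrier G" "\<beta> = ?inner a" using \<beta> by (auto simp: Inn_def)
    have hom: "\<alpha> \<in> hom G G" using \<alpha> by (simp add: AutoGroup_def auto_def)
    interpret \<alpha>: group_hom G G \<alpha>
      by (simp add: group_hom_def group_hom_axioms_def group_axioms hom)
    have Bij: "\<alpha> \<in> Bij (carrier G)" "?inner b \<in> Bij (carrier G)" if "b \<in> carrier G" for b
      using \<alpha> inner.hom_closed[OF that] by (simp_all add: AutoGroup_def auto_def)
    have "\<alpha> \<otimes>\<^bsub>AutoGroup G\<^esub> \<beta> = ?inner (\<alpha> a) \<otimes>\<^bsub>AutoGroup G\<^esub> \<alpha>"
      unfolding a(2) using a(1) Bij[of a] Bij[of "\<alpha> a"] \<alpha>.hom_closed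
      by (auto simp: AutoGroup_def BijGroup_def compose_def fun_eq_iff)
    then have "\<alpha> \<otimes>\<^bsub>AutoGroup G\<^esub> \<beta> \<otimes>\<^bsub>AutoGroup G\<^esub> inv\<^bsub>AutoGroup G\<^esub> \<alpha> = ?inner (\<alpha> a)"
      using a \<alpha> inner.hom_closed by (simp add: A.m_assoc)
    then show ?thesis using a(1) \<alpha>.hom_closed by (auto simp: Inn_def)
  qed
  then show ?thesis
    using sub by (simp add: A.normal_inv_iff)
qed

lemma (in group) group_OutGroup: "group (OutGroup G)"
  unfolding OutGroup_def by (rule normal.factorgroup_is_group[OF Inn_normal])

lemma (in group) outer_class_hom: "outer_class G \<in> hom (AutoGroup G) (OutGroup G)"
  using normal.r_coset_hom_Mod[OF Inn_normal] unfolding OutGroup_def outer_class_def .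

lemma (in group) outer_class_eq_one_iff:
  assumes "\<alpha> \<in> carrier (AutoGroup G)"
  shows "outer_class G \<alpha> = \<one>\<^bsub>OutGroup G\<^esub> \<longleftrightarrow> \<alpha> \<in> Inn G"
proof -
  interpret A: group "AutoGroup G" by (rule AutoGroup)
  show ?thesis
    using assms A.coset_join1[of "Inn G" \<alpha>] A.coset_join2[of \<alpha> "Inn G"]
      normal_imp_subgroup[OF Inn_normal]
    by (auto simp: outer_class_def OutGroup_def FactGroup_def)
qed

section \<open>The monodromy action\<close>

context two_groups
begin

lemma fibre_conj_hom: "fibre_conj G H \<in> hom P (AutoGroup F)"
proof -
  have "fibre_conj G H = (\<lambda>x. \<lambda>w\<in>N. x \<otimes>\<^bsub>P\<^esub> w \<otimes>\<^bsub>P\<^esub> inv\<^bsub>P\<^esub> x)"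
    by (simp add: fibre_conj_def fun_eq_iff)
  then show ?thesis
    using P.normal_conj_hom[OF N_normal] by (simp add: fibre_group_def)
qed

lemma fibre_conj_inner:
  assumes "x \<in> N"
  shows "fibre_conj G H x \<in> Inn F"
  unfolding Inn_def
  by (rule image_eqI[of _ _ x]) (use assms in \<open>auto simp: fibre_conj_def fun_eq_iff\<close>)

lemma conj_class_hom: "(\<lambda>x. outer_class F (fibre_conj G H x)) \<in> hom P (OutGroup F)"
  using hom_compose[OF fibre_conj_hom group.outer_class_hom[OF group_F]] by (simp add: comp_def)

text \<open>Two lifts of the same element of the direct product differ by an element of the kernel, whose
  conjugation is inner. Hence the set in the definition of the monodromy is a singleton.\<close>

lemma conj_class_cong:
  assumes "x \<in> carrier P" "y \<in> carrier P" "fp_proj G H x = fp_proj G H y"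
  shows "outer_class F (fibre_conj G H x) = outer_class F (fibre_conj G H y)"
proof -
  interpret Out: group "OutGroup F" by (rule group.group_OutGroup[OF group_F])
  interpret q: group_hom P "OutGroup F" "\<lambda>x. outer_class F (fibre_conj G H x)"
    by (simp add: group_hom_def group_hom_axioms_def group_P Out.group_axioms conj_class_hom)
  let ?z = "x \<otimes>\<^bsub>P\<^esub> inv\<^bsub>P\<^esub> y"
  have z: "?z \<in> N"
    using assms proj.hom_closed[OF assms(2)] group.r_inv[OF group_GH]
    by (simp add: kernel_def del: carrier_DirProd one_DirProd)
  then have one: "outer_class F (fibre_conj G H ?z) = \<one>\<^bsub>OutGroup F\<^esub>"
    using fibre_conj_inner group.outer_class_eq_one_iff[OF group_F]
      hom_in_carrier[OF fibre_conj_hom, of ?z] assms by blast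
  have "outer_class F (fibre_conj G H x) = outer_class F (fibre_conj G H (?z \<otimes>\<^bsub>P\<^esub> y))"
    using assms by (simp add: P.m_assoc del: q.hom_mult)
  also have "\<dots> = outer_class F (fibre_conj G H ?z) \<otimes>\<^bsub>OutGroup F\<^esub> outer_class F (fibre_conj G H y)"
    using assms by (intro q.hom_mult) simp_all
  also have "\<dots> = outer_class F (fibre_conj G H y)"
    unfolding one using assms by simp
  finally show ?thesis .
qed

lemma monodromy_proj:
  assumes "x \<in> carrier P"
  shows "monodromy G H (fp_proj G H x) = outer_class F (fibre_conj G H x)"
  unfolding monodromy_def
proof (rule the_elem_image_unique)
  fix y assume "y \<in> {y \<in> carrier P. fp_proj G H y = fp_proj G H x}"
  then show "outer_class F (fibre_conj G H y) = outer_class F (fibre_conj G H x)"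
    using assms by (intro conj_class_cong) auto
qed (use assms in blast)

lemma proj_surj:
  assumes "t \<in> carrier (G \<times>\<times> H)"
  shows "\<exists>x\<in>carrier P. fp_proj G H x = t"
  using assms
  by (intro bexI[of _ "\<iota> (fst t) \<otimes>\<^bsub>P\<^esub> \<kappa> (snd t)"]) (auto simp: proj_inl proj_inr)

lemma monodromy_hom: "monodromy G H \<in> hom (G \<times>\<times> H) (OutGroup F)"
proof (rule homI)
  fix s assume "s \<in> carrier (G \<times>\<times> H)"
  then obtain x where x: "x \<in> carrier P" "fp_proj G H x = s" using proj_surj by blast
  then show "monodromy G H s \<in> carrier (OutGroup F)"
    using hom_in_carrier[OF conj_class_hom x(1)] monodromy_proj[OF x(1)] by simp
  fix t assume "t \<in> carrier (G \<times>\<times> H)"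
  then obtain y where y: "y \<in> carrier P" "fp_proj G H y = t" using proj_surj by blast
  show "monodromy G H (s \<otimes>\<^bsub>G \<times>\<times> H\<^esub> t) = monodromy G H s \<otimes>\<^bsub>OutGroup F\<^esub> monodromy G H t"
    using monodromy_proj[of "x \<otimes>\<^bsub>P\<^esub> y"] monodromy_proj[OF x(1)] monodromy_proj[OF y(1)]
      hom_mult[OF conj_class_hom x(1) y(1)] x y by simp
qed

lemma fp_conj_left:
  assumes "l \<in> carrier G" "g \<in> carrier G" "h \<in> carrier H"
  shows "\<iota> l \<otimes>\<^bsub>P\<^esub> c g h \<otimes>\<^bsub>P\<^esub> inv\<^bsub>P\<^esub> \<iota> l
    = c (l \<otimes>\<^bsub>G\<^esub> g) h \<otimes>\<^bsub>P\<^esub> fp_comm G H (\<kappa> h) (\<iota> l)"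
  using assms by (simp add: fp_comm_def P.conj_commutator_left inl_mult)

lemma fp_conj_right:
  assumes "l \<in> carrier H" "g \<in> carrier G" "h \<in> carrier H"
  shows "\<kappa> l \<otimes>\<^bsub>P\<^esub> c g h \<otimes>\<^bsub>P\<^esub> inv\<^bsub>P\<^esub> \<kappa> l
    = fp_comm G H (\<kappa> l) (\<iota> g) \<otimes>\<^bsub>P\<^esub> c g (l \<otimes>\<^bsub>H\<^esub> h)"
  using assms by (simp add: fp_comm_def P.conj_commutator_right inr_mult)

lemma fp_comm_swap:
  "g \<in> carrier G \<Longrightarrow> h \<in> carrier H \<Longrightarrow> fp_comm G H (\<kappa> h) (\<iota> g) = inv\<^bsub>P\<^esub> c g h"
  by (simp add: fp_comm_def P.inv_commutator)

subsection \<open>Faithfulness\<close>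

text \<open>If \<open>(g0, h0)\<close> acts by an inner automorphism, then every homomorphism from the kernel to the
  integers is invariant under conjugation by the lift \<open>g0 h0\<close>. The equation is this invariance at
  \<open>[g, h]\<close>, for the homomorphism that sends \<open>[a, b]\<close> to \<open>\<sigma> a b\<close>.\<close>

lemma trivial_class_invariant:
  fixes \<sigma> :: "'a \<Rightarrow> 'b \<Rightarrow> int"
  assumes g0: "g0 \<in> carrier G" and h0: "h0 \<in> carrier H"
    and trivial: "monodromy G H (g0, h0) = \<one>\<^bsub>OutGroup F\<^esub>"
    and \<sigma>_one: "\<And>h. h \<in> carrier H \<Longrightarrow> \<sigma> \<one>\<^bsub>G\<^esub> h = 0" "\<And>g. g \<in> carrier G \<Longrightarrow> \<sigma> g \<one>\<^bsub>H\<^esub> = 0"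
    and g: "g \<in> carrier G" and h: "h \<in> carrier H"
  shows "\<sigma> g h = \<sigma> (g0 \<otimes>\<^bsub>G\<^esub> g) (h0 \<otimes>\<^bsub>H\<^esub> h) - \<sigma> g0 (h0 \<otimes>\<^bsub>H\<^esub> h) - \<sigma> (g0 \<otimes>\<^bsub>G\<^esub> g) h0 + \<sigma> g0 h0"
proof -
  interpret F: group F by (rule group_F)
  obtain \<Psi> where \<Psi>: "\<Psi> \<in> hom F integer_group"
    "\<And>g h. g \<in> carrier G \<Longrightarrow> h \<in> carrier H \<Longrightarrow> \<Psi> (c g h) = \<sigma> g h"
    using fibre_universal[of integer_group \<sigma>] \<sigma>_one by auto
  interpret \<Psi>: group_hom F integer_group \<Psi>
    by (simp add: group_hom_def group_hom_axioms_def F.group_axioms \<Psi>)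
  have \<Psi>_mult: "\<Psi> (x \<otimes>\<^bsub>P\<^esub> y) = \<Psi> x + \<Psi> y" if "x \<in> N" "y \<in> N" for x y
    using \<Psi>.hom_mult[of x y] that by simp
  have "\<Psi> \<one>\<^bsub>P\<^esub> = 0" using \<Psi>.hom_one by simp
  then have \<Psi>_inv: "\<Psi> (inv\<^bsub>P\<^esub> x) = - \<Psi> x" if "x \<in> N" for x
    using \<Psi>_mult[of x "inv\<^bsub>P\<^esub> x"] that subgroup.m_inv_closed[OF N_subgroup that]
    by (simp add: kernel_def)
  let ?x = "\<iota> g0 \<otimes>\<^bsub>P\<^esub> \<kappa> h0"
  have x: "?x \<in> carrier P" "fp_proj G H ?x = (g0, h0)"
    using g0 h0 by (simp_all add: proj_inl proj_inr)
  have "outer_class F (fibre_conj G H ?x) = \<one>\<^bsub>OutGroup F\<^esub>"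
    using monodromy_proj[OF x(1)] trivial by (simp only: x(2))
  then have "fibre_conj G H ?x \<in> Inn F"
    using group.outer_class_eq_one_iff[OF group_F hom_in_carrier[OF fibre_conj_hom x(1)]]
    by (simp only:)
  then obtain f where f: "f \<in> N" "fibre_conj G H ?x = (\<lambda>w\<in>N. f \<otimes>\<^bsub>P\<^esub> w \<otimes>\<^bsub>P\<^esub> inv\<^bsub>P\<^esub> f)"
    by (auto simp: Inn_def fun_eq_iff restrict_def)
  have fN: "inv\<^bsub>P\<^esub> f \<in> N" "f \<otimes>\<^bsub>P\<^esub> c g h \<in> N"
    using f(1) g h subgroup.m_inv_closed[OF N_subgroup] subgroup.m_closed[OF N_subgroup] by auto
  have "?x \<otimes>\<^bsub>P\<^esub> c g h \<otimes>\<^bsub>P\<^esub> inv\<^bsub>P\<^esub> ?x = f \<otimes>\<^bsub>P\<^esub> c g h \<otimes>\<^bsub>P\<^esub> inv\<^bsub>P\<^esub> f"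
    using fun_cong[OF f(2), of "c g h"] g h by (simp add: fibre_conj_def)
  then have "\<Psi> (?x \<otimes>\<^bsub>P\<^esub> c g h \<otimes>\<^bsub>P\<^esub> inv\<^bsub>P\<^esub> ?x) = \<Psi> (f \<otimes>\<^bsub>P\<^esub> c g h \<otimes>\<^bsub>P\<^esub> inv\<^bsub>P\<^esub> f)"
    by simp
  also have "\<dots> = \<sigma> g h"
    using f(1) fN g h by (simp add: \<Psi>_mult \<Psi>_inv \<Psi>(2) c_in_N)
  finally have lhs: "\<Psi> (?x \<otimes>\<^bsub>P\<^esub> c g h \<otimes>\<^bsub>P\<^esub> inv\<^bsub>P\<^esub> ?x) = \<sigma> g h" .
  let ?L = "\<lambda>w. \<iota> g0 \<otimes>\<^bsub>P\<^esub> w \<otimes>\<^bsub>P\<^esub> inv\<^bsub>P\<^esub> \<iota> g0"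
  have L_c: "?L (c g h) = c (g0 \<otimes>\<^bsub>G\<^esub> g) h \<otimes>\<^bsub>P\<^esub> inv\<^bsub>P\<^esub> c g0 h" if "g \<in> carrier G" "h \<in> carrier H" for g h
    using fp_conj_left[OF g0 that] g0 that by (simp add: fp_comm_swap)
  have inv_c: "inv\<^bsub>P\<^esub> c g h \<in> N" if "g \<in> carrier G" "h \<in> carrier H" for g h
    using that c_in_N subgroup.m_inv_closed[OF N_subgroup] by blast
  have \<Psi>_L: "\<Psi> (?L (c g h)) = \<sigma> (g0 \<otimes>\<^bsub>G\<^esub> g) h - \<sigma> g0 h" and L_N: "?L (c g h) \<in> N"
    if "g \<in> carrier G" "h \<in> carrier H" for g h
    using that g0 inv_c c_in_N subgroup.m_closed[OF N_subgroup]
    by (simp_all add: L_c \<Psi>_mult \<Psi>_inv \<Psi>(2))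
  have "?x \<otimes>\<^bsub>P\<^esub> c g h \<otimes>\<^bsub>P\<^esub> inv\<^bsub>P\<^esub> ?x = ?L (\<kappa> h0 \<otimes>\<^bsub>P\<^esub> c g h \<otimes>\<^bsub>P\<^esub> inv\<^bsub>P\<^esub> \<kappa> h0)"
    using g0 h0 g h by (simp add: P.m_assoc P.inv_mult_group)
  also have "\<dots> = ?L (inv\<^bsub>P\<^esub> c g h0 \<otimes>\<^bsub>P\<^esub> c g (h0 \<otimes>\<^bsub>H\<^esub> h))"
    using fp_conj_right[OF h0 g h] g h0 by (simp add: fp_comm_swap)
  also have "\<dots> = inv\<^bsub>P\<^esub> (?L (c g h0)) \<otimes>\<^bsub>P\<^esub> ?L (c g (h0 \<otimes>\<^bsub>H\<^esub> h))"
    using g0 h0 g h by (simp add: P.m_assoc P.inv_mult_group P.mult_inv_cancel)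
  finally show ?thesis
    using lhs g h g0 h0 \<Psi>_L L_N subgroup.m_inv_closed[OF N_subgroup L_N[of g h0]]
    by (simp add: \<Psi>_mult \<Psi>_inv)
qed

lemma monodromy_faithful:
  assumes fin: "finite (carrier G)" "finite (carrier H)"
    and k: "(order G - 1) * (order H - 1) \<ge> 2"
  shows "inj_on (monodromy G H) (carrier (G \<times>\<times> H))"
proof -
  interpret GH: group "G \<times>\<times> H" by (rule group_GH)
  have "t = \<one>\<^bsub>G \<times>\<times> H\<^esub>"
    if t: "t \<in> carrier (G \<times>\<times> H)" and triv: "monodromy G H t = \<one>\<^bsub>OutGroup F\<^esub>" for t
  proof (rule ccontr)
    obtain g0 h0 where gh0: "t = (g0, h0)" "g0 \<in> carrier G" "h0 \<in> carrier H" using t by auto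
    assume "t \<noteq> \<one>\<^bsub>G \<times>\<times> H\<^esub>"
    then have nontriv: "g0 \<noteq> \<one>\<^bsub>G\<^esub> \<or> h0 \<noteq> \<one>\<^bsub>H\<^esub>" by (simp add: gh0)
    have "card I = (order G - 1) * (order H - 1)"
      using fin by (simp add: card_cartesian_product order_def)
    with k have "card I > card {(g0, h0)}" by simp
    then have "\<not> I \<subseteq> {(g0, h0)}"
      using card_mono[of "{(g0, h0)}" I] by auto
    then obtain g h where gh: "g \<in> carrier G" "g \<noteq> \<one>\<^bsub>G\<^esub>" "h \<in> carrier H" "h \<noteq> \<one>\<^bsub>H\<^esub>"
      "(g, h) \<noteq> (g0, h0)" by blast
    \<comment> \<open>As \<open>I\<close> has at least two elements, one can choose \<open>(g, h)\<close> different from \<open>(g0, h0)\<close>. Then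
      the coefficient of \<open>[g, h]\<close> in its image, a diagonal entry of the action on the
      abelianization, is at most \<open>0\<close> instead of \<open>1\<close>.\<close>
    define \<sigma> :: "'a \<Rightarrow> 'b \<Rightarrow> int" where "\<sigma> a b = (if a = g \<and> b = h then 1 else 0)" for a b
    have "\<sigma> g h = \<sigma> (g0 \<otimes>\<^bsub>G\<^esub> g) (h0 \<otimes>\<^bsub>H\<^esub> h) - \<sigma> g0 (h0 \<otimes>\<^bsub>H\<^esub> h)
        - \<sigma> (g0 \<otimes>\<^bsub>G\<^esub> g) h0 + \<sigma> g0 h0"
      by (rule trivial_class_invariant) (use gh0 triv gh in \<open>auto simp: \<sigma>_def\<close>)
    moreover have "\<sigma> (g0 \<otimes>\<^bsub>G\<^esub> g) (h0 \<otimes>\<^bsub>H\<^esub> h) = 0"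
      using nontriv gh gh0 by (auto simp: \<sigma>_def)
    moreover have "\<sigma> g0 h0 = 0" "\<sigma> g h = 1" using gh(5) by (auto simp: \<sigma>_def)
    moreover have "\<sigma> g0 (h0 \<otimes>\<^bsub>H\<^esub> h) \<ge> 0" "\<sigma> (g0 \<otimes>\<^bsub>G\<^esub> g) h0 \<ge> 0" by (auto simp: \<sigma>_def)
    ultimately show False by linarith
  qed
  then show ?thesis
    using inj_on_one_iff'[OF monodromy_hom group_GH group.group_OutGroup[OF group_F]] by blast
qed

end

section \<open>The Denham--Suciu monodromy\<close>

theorem proposition1p1:
  fixes G :: "('a, 'c) monoid_scheme" and H :: "('b, 'd) monoid_scheme"
    and m n k :: nat
  assumes "group G" and "finite (carrier G)" and "order G = m"
    and "group H" and "finite (carrier H)" and "order H = n"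
    and "k = (m - 1) * (n - 1)"
  shows
    "(let P = free_product G H; F = fibre_group G H;
          \<iota> = fp_inl G H; \<kappa> = fp_inr G H; com = fp_comm G H;
          B = {com (\<iota> g) (\<kappa> h) | g h.
                 g \<in> carrier G - {\<one>\<^bsub>G\<^esub>} \<and> h \<in> carrier H - {\<one>\<^bsub>H\<^esub>}}
      in
        \<comment> \<open>the kernel is free of rank \<open>k\<close> on the commutators\<close>
        free_basis F B \<and> finite B \<and> card B = k \<and>
        \<comment> \<open>the monodromy is the homomorphism induced by conjugation\<close>
        monodromy G H \<in> hom (G \<times>\<times> H) (OutGroup F) \<and>
        (\<forall>x\<in>carrier P. fibre_conj G H x \<in> carrier (AutoGroup F) \<and>
           monodromy G H (fp_proj G H x) = outer_class F (fibre_conj G H x)) \<and>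
        \<comment> \<open>faithfulness; it fails exactly when \<open>m = n = 2\<close> or just one of the groups is trivial\<close>
        (k \<ge> 2 \<or> (m = 1 \<and> n = 1) \<longrightarrow> inj_on (monodromy G H) (carrier (G \<times>\<times> H))) \<and>
        \<comment> \<open>the explicit equations\<close>
        (\<forall>l\<in>carrier G.
           monodromy G H (l, \<one>\<^bsub>H\<^esub>) = outer_class F (fibre_conj G H (\<iota> l)) \<and>
           (\<forall>g\<in>carrier G. \<forall>h\<in>carrier H.
              fibre_conj G H (\<iota> l) (com (\<iota> g) (\<kappa> h))
                = \<iota> l \<otimes>\<^bsub>P\<^esub> com (\<iota> g) (\<kappa> h) \<otimes>\<^bsub>P\<^esub> inv\<^bsub>P\<^esub> \<iota> l \<and>
              \<iota> l \<otimes>\<^bsub>P\<^esub> com (\<iota> g) (\<kappa> h) \<otimes>\<^bsub>P\<^esub> inv\<^bsub>P\<^esub> \<iota> l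
                = com (\<iota> (l \<otimes>\<^bsub>G\<^esub> g)) (\<kappa> h) \<otimes>\<^bsub>P\<^esub> com (\<kappa> h) (\<iota> l))) \<and>
        (\<forall>l\<in>carrier H.
           monodromy G H (\<one>\<^bsub>G\<^esub>, l) = outer_class F (fibre_conj G H (\<kappa> l)) \<and>
           (\<forall>g\<in>carrier G. \<forall>h\<in>carrier H.
              fibre_conj G H (\<kappa> l) (com (\<iota> g) (\<kappa> h))
                = \<kappa> l \<otimes>\<^bsub>P\<^esub> com (\<iota> g) (\<kappa> h) \<otimes>\<^bsub>P\<^esub> inv\<^bsub>P\<^esub> \<kappa> l \<and>
              \<kappa> l \<otimes>\<^bsub>P\<^esub> com (\<iota> g) (\<kappa> h) \<otimes>\<^bsub>P\<^esub> inv\<^bsub>P\<^esub> \<kappa> l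
                = com (\<kappa> l) (\<iota> g) \<otimes>\<^bsub>P\<^esub> com (\<iota> g) (\<kappa> (l \<otimes>\<^bsub>H\<^esub> h)))))"
proof -
  interpret two_groups G H
    using assms by (simp add: two_groups_def)
  have B: "{c g h | g h. g \<in> carrier G - {\<one>\<^bsub>G\<^esub>} \<and> h \<in> carrier H - {\<one>\<^bsub>H\<^esub>}} = case_prod c ` I"
    by force
  have "finite I" and "card I = k"
    using assms by (auto simp: card_cartesian_product order_def)
  then have finite: "finite (case_prod c ` I)" and card: "card (case_prod c ` I) = k"
    using card_image[OF inj_c] by simp_all
  have faithful: "inj_on (monodromy G H) (carrier (G \<times>\<times> H))" if "k \<ge> 2 \<or> (m = 1 \<and> n = 1)"
    using that
  proof
    assume "k \<ge> 2"
    then show ?thesis using monodromy_faithful assms by simp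
  next
    assume "m = 1 \<and> n = 1"
    then obtain a b where "carrier G = {a}" "carrier H = {b}"
      using assms by (auto simp: order_def card_1_singleton_iff)
    then show ?thesis by simp
  qed
  have conj: "fibre_conj G H x (c g h) = x \<otimes>\<^bsub>P\<^esub> c g h \<otimes>\<^bsub>P\<^esub> inv\<^bsub>P\<^esub> x"
    if "g \<in> carrier G" "h \<in> carrier H" for x g h
    using that by (simp add: fibre_conj_def)
  have class_left: "monodromy G H (l, \<one>\<^bsub>H\<^esub>) = outer_class F (fibre_conj G H (\<iota> l))" if "l \<in> carrier G" for l
    using monodromy_proj[of "\<iota> l"] that by (simp add: proj_inl)
  have class_right: "monodromy G H (\<one>\<^bsub>G\<^esub>, l) = outer_class F (fibre_conj G H (\<kappa> l))" if "l \<in> carrier H" for l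
    using monodromy_proj[of "\<kappa> l"] that by (simp add: proj_inr)
  show ?thesis
    unfolding Let_def B
    by (intro conjI ballI impI fibre_free_basis finite card monodromy_hom faithful monodromy_proj
        hom_in_carrier[OF fibre_conj_hom] class_left class_right conj fp_conj_left fp_conj_right)
qed

end
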